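(* Let $K\ge 1$ be an integer, let $a,b,c,d$ and $a_k,d_k,r_k$ ($1\le k\le K$) be real numbers with $bc\ge 0$, and let $\boldsymbol{A}=\{A_0,\dots,A_K\}\subset\mathbb{R}^{2\times 2}$, where $$A_0=\begin{bmatrix} a & b \\ c & d \end{bmatrix},\quad A_k=\begin{bmatrix} a_k & r_k b \\ {r_k} c & d_k \end{bmatrix}\quad (1\le k\le K).$$ Then $\boldsymbol{A}$ is absolutely stable if and only if $\rho(A_k)<1$ for all $0\le k\le K$.
   Context: For a square matrix $M$, $\rho(M)$ denotes its usual spectral radius (the maximum modulus of its complex eigenvalues). For a finite set $\boldsymbol{A}$ of real square matrices of the same size and $n\ge 1$, put $\boldsymbol{A}^n=\{M_1\cdots M_n : M_i\in\boldsymbol{A}\text{ for }1\le i\le n\}$. The set $\boldsymbol{A}$ is absolutely stable if $\max_{M\in\boldsymbol{A}^n}\|M\|\to 0$ as $n\to+\infty$, where $\|\cdot\|$ is any matrix norm (the condition does not depend on the choice of norm). *)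

theory Defs
  imports "HOL-Analysis.Analysis" "Jordan_Normal_Form.Spectral_Radius"
begin

(* Only the vector-space axioms are required, so submultiplicative norms are a special case. *)
definition matrix_norm :: "nat \<Rightarrow> (real mat \<Rightarrow> real) \<Rightarrow> bool" where
  "matrix_norm d N \<longleftrightarrow>
     (\<forall>X \<in> carrier_mat d d. N X = 0 \<longleftrightarrow> X = 0\<^sub>m d d) \<and>
     (\<forall>X \<in> carrier_mat d d. \<forall>r. N (r \<cdot>\<^sub>m X) = \<bar>r\<bar> * N X) \<and>
     (\<forall>X \<in> carrier_mat d d. \<forall>Y \<in> carrier_mat d d. N (X + Y) \<le> N X + N Y)"

definition mat_set_power :: "nat \<Rightarrow> real mat set \<Rightarrow> nat \<Rightarrow> real mat set" where
  "mat_set_power d S n = {foldr (*) Ms (1\<^sub>m d) | Ms. length Ms = n \<and> set Ms \<subseteq> S}"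

(* Meant for finite nonempty S, where every mat_set_power d S n is finite and
   nonempty, so that Max is the true maximum. *)
definition absolutely_stable :: "(real mat \<Rightarrow> real) \<Rightarrow> nat \<Rightarrow> real mat set \<Rightarrow> bool" where
  "absolutely_stable N d S \<longleftrightarrow> (\<lambda>n. Max (N ` mat_set_power d S n)) \<longlonglongrightarrow> 0"

(* The usual spectral radius over the complex numbers; the eigenvalues of a real matrix
   need not be real. *)
definition real_spectral_radius :: "real mat \<Rightarrow> real" where
  "real_spectral_radius M = spectral_radius (map_mat complex_of_real M)"

end

theory Submission
  imports Defs
begin

text \<open>If \<open>b * c > 0\<close>, all \<open>A k\<close> are self-adjoint for the inner product with weights \<open>\<bar>c\<bar>, \<bar>b\<bar>\<close>, so
  the operator norm attached to it equals the spectral radius on each of them. If \<open>b * c = 0\<close>, all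
  \<open>A k\<close> are triangular of the same kind, and a weighted maximum norm makes the off-diagonal entries
  negligible. Either way one vector norm is contracted by all \<open>A k\<close> at once. Conversely, an
  eigenvalue \<open>z\<close> of \<open>A k\<close> with \<open>\<bar>z\<bar> \<ge> 1\<close> prevents the powers of \<open>A k\<close> from tending to \<open>0\<close>.\<close>

section \<open>Equivalence of norms in finite dimension\<close>

text \<open>Expanding in the basis gives the upper constant; it makes \<open>f\<close> Lipschitz, so
  \<open>f\<close> attains a minimum on the compact unit sphere. That minimum is positive by
  definiteness and serves, by homogeneity, as the lower constant.\<close>

lemma euclidean_norm_equivalence:
  fixes f :: "'a::euclidean_space \<Rightarrow> real"
  assumes zero: "\<And>x. f x = 0 \<longleftrightarrow> x = 0"
    and scale: "\<And>r x. f (r *\<^sub>R x) = \<bar>r\<bar> * f x"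
    and add: "\<And>x y. f (x + y) \<le> f x + f y"
  obtains l u where "l > 0" "u > 0" "\<And>x. l * norm x \<le> f x" "\<And>x. f x \<le> u * norm x"
proof -
  have neg: "f (- x) = f x" for x
    using scale[of "-1" x] by simp
  have nonneg: "0 \<le> f x" for x
    using add[of x "- x"] zero[of 0] by (simp add: neg)
  \<comment> \<open>The summand 1 makes \<open>u > 0\<close> immediate from the nonnegativity of
    \<open>f\<close>.\<close>
  define u where "u = (\<Sum>b\<in>Basis. f b) + 1"
  have sum_le: "f (\<Sum>b\<in>B. g b) \<le> (\<Sum>b\<in>B. f (g b))" if "finite B" for B :: "'a set" and g
    using that
  proof (induction B rule: finite_induct)
    case empty
    then show ?case using zero[of 0] by simp
  next
    case (insert b B)
    then show ?case using add[of "g b" "sum g B"] by simp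
  qed
  have upper: "f x \<le> u * norm x" for x
  proof -
    have "f x = f (\<Sum>b\<in>Basis. (x \<bullet> b) *\<^sub>R b)"
      by (simp add: euclidean_representation)
    also have "\<dots> \<le> (\<Sum>b\<in>Basis. f ((x \<bullet> b) *\<^sub>R b))"
      by (rule sum_le) simp
    also have "\<dots> \<le> (\<Sum>b\<in>Basis. norm x * f b)"
      by (rule sum_mono) (auto simp: scale intro!: mult_right_mono Basis_le_norm nonneg)
    also have "\<dots> \<le> u * norm x"
      by (simp add: u_def sum_distrib_left algebra_simps)
    finally show ?thesis .
  qed
  have u: "u > 0"
    unfolding u_def by (intro add_nonneg_pos sum_nonneg nonneg) simp
  have lip: "\<bar>f x - f y\<bar> \<le> u * norm (x - y)" for x y
    using add[of "x - y" y] add[of "y - x" x] neg[of "x - y"] upper[of "x - y"] by simp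
  have "continuous_on (sphere 0 1) f"
    by (rule lipschitz_on_continuous_on[of u], rule lipschitz_onI)
      (use lip u in \<open>auto simp: dist_norm\<close>)
  moreover have "sphere (0::'a) 1 \<noteq> {}"
    by simp
  ultimately obtain w where w: "w \<in> sphere 0 1" "\<And>y. y \<in> sphere 0 1 \<Longrightarrow> f w \<le> f y"
    using continuous_attains_inf[of "sphere (0::'a) 1" f] by auto
  have "f w > 0"
    using w(1) zero[of w] nonneg[of w] by (auto simp: less_le)
  moreover have "f w * norm x \<le> f x" for x
  proof (cases "x = 0")
    case True
    then show ?thesis using nonneg by simp
  next
    case False
    then have "f w \<le> f ((1 / norm x) *\<^sub>R x)"
      by (intro w(2)) simp
    then show ?thesis using False by (simp add: scale field_simps)
  qed
  ultimately show ?thesis using that u upper by blast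
qed

section \<open>Two-by-two matrices\<close>

abbreviation mat2 :: "'a \<Rightarrow> 'a \<Rightarrow> 'a \<Rightarrow> 'a \<Rightarrow> 'a mat" where
  "mat2 p q s t \<equiv> mat_of_rows_list 2 [[p, q], [s, t]]"

lemma mat2_carrier [simp]: "mat2 p q s t \<in> carrier_mat 2 2"
  by (rule carrier_matI) (simp_all add: mat_of_rows_list_def)

lemma mat2_dim [simp]: "dim_row (mat2 p q s t) = 2" "dim_col (mat2 p q s t) = 2"
  by (simp_all add: mat_of_rows_list_def)

lemma mat2_index [simp]:
  "mat2 p q s t $$ (0, 0) = p" "mat2 p q s t $$ (0, Suc 0) = q"
  "mat2 p q s t $$ (Suc 0, 0) = s" "mat2 p q s t $$ (Suc 0, Suc 0) = t"
  by (simp_all add: mat_of_rows_list_def)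

lemma eq_mat2I:
  assumes "X \<in> carrier_mat 2 2" "Y \<in> carrier_mat 2 2"
    and "X $$ (0, 0) = Y $$ (0, 0)" "X $$ (0, Suc 0) = Y $$ (0, Suc 0)"
    and "X $$ (Suc 0, 0) = Y $$ (Suc 0, 0)" "X $$ (Suc 0, Suc 0) = Y $$ (Suc 0, Suc 0)"
  shows "X = Y"
proof (rule eq_matI)
  show "dim_row X = dim_row Y" "dim_col X = dim_col Y"
    using carrier_matD[OF assms(1)] carrier_matD[OF assms(2)] by simp_all
  fix i j assume "i < dim_row Y" "j < dim_col Y"
  then have "(i = 0 \<or> i = Suc 0) \<and> (j = 0 \<or> j = Suc 0)"
    using carrier_matD[OF assms(2)] by (simp add: less_2_cases_iff)
  with assms(3-6) show "X $$ (i, j) = Y $$ (i, j)"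
    by blast
qed

lemma mat2_mult_index:
  assumes "X \<in> carrier_mat 2 2" "Y \<in> carrier_mat 2 2" "i < 2" "j < 2"
  shows "(X * Y) $$ (i, j) = X $$ (i, 0) * Y $$ (0, j) + X $$ (i, Suc 0) * Y $$ (Suc 0, j)"
proof -
  have "(X * Y) $$ (i, j) = (\<Sum>k\<in>{0..<2}. X $$ (i, k) * Y $$ (k, j))"
    using assms by (simp add: scalar_prod_def)
  then show ?thesis
    by (simp add: numeral_2_eq_2 del: index_mult_mat)
qed

lemma mat2_mult_vec_index:
  assumes "X \<in> carrier_mat 2 2" "v \<in> carrier_vec 2" "i < 2"
  shows "(X *\<^sub>v v) $ i = X $$ (i, 0) * v $ 0 + X $$ (i, Suc 0) * v $ Suc 0"
proof -
  have "(X *\<^sub>v v) $ i = (\<Sum>k\<in>{0..<2}. X $$ (i, k) * v $ k)"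
    using assms by (simp add: scalar_prod_def)
  then show ?thesis
    by (simp add: numeral_2_eq_2 del: index_mult_mat_vec)
qed

text \<open>This is how an arbitrary norm enters the proof: only through its comparison with the
  largest entry. The carrier set is not a type of its own, so norm equivalence is applied on
  quadruples of reals and transported along the coordinate map \<open>g\<close> and its inverse
  \<open>h\<close>.\<close>

lemma matrix_norm_2_entries:
  assumes "matrix_norm 2 N"
  obtains l u where "l > 0" "u > 0"
    "\<And>X i j. X \<in> carrier_mat 2 2 \<Longrightarrow> i < 2 \<Longrightarrow> j < 2 \<Longrightarrow> l * \<bar>X $$ (i, j)\<bar> \<le> N X"
    "\<And>X B. X \<in> carrier_mat 2 2 \<Longrightarrow> (\<And>i j. i < 2 \<Longrightarrow> j < 2 \<Longrightarrow> \<bar>X $$ (i, j)\<bar> \<le> B) \<Longrightarrow> N X \<le> u * B"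
proof -
  define g :: "real \<times> real \<times> real \<times> real \<Rightarrow> real mat"
    where "g = (\<lambda>(p, q, s, t). mat2 p q s t)"
  have g [simp]: "g v \<in> carrier_mat 2 2" for v
    by (cases v) (simp add: g_def)
  have dim [simp]: "dim_row (g v) = 2" "dim_col (g v) = 2" for v
    using g[of v] by (auto simp del: g)
  have idx [simp]: "g (p, q, s, t) $$ (0, 0) = p" "g (p, q, s, t) $$ (0, Suc 0) = q"
    "g (p, q, s, t) $$ (Suc 0, 0) = s" "g (p, q, s, t) $$ (Suc 0, Suc 0) = t" for p q s t
    by (simp_all add: g_def)
  have g_zero: "g v = 0\<^sub>m 2 2 \<longleftrightarrow> v = 0" for v
  proof (cases v)
    case (fields p q s t)
    have "p = 0 \<and> q = 0 \<and> s = 0 \<and> t = 0" if *: "g (p, q, s, t) = 0\<^sub>m 2 2"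
      using idx[of p q s t] unfolding * by simp
    moreover have "g (0, 0, 0, 0) = 0\<^sub>m 2 2"
      by (rule eq_mat2I) auto
    ultimately show ?thesis
      by (auto simp: fields zero_prod_def)
  qed
  have g_scale: "g (r *\<^sub>R v) = r \<cdot>\<^sub>m g v" for r v
    by (cases v) (auto intro!: eq_mat2I)
  have g_add: "g (v + w) = g v + g w" for v w
    by (cases v, cases w) (auto intro!: eq_mat2I)
  have "N (g v) = 0 \<longleftrightarrow> v = 0" "N (g (r *\<^sub>R v)) = \<bar>r\<bar> * N (g v)" "N (g (v + w)) \<le> N (g v) + N (g w)"
    for v w r
    using assms g unfolding matrix_norm_def g_scale g_add by (simp_all add: g_zero)
  then obtain l u where lu: "l > 0" "u > 0" "\<And>v. l * norm v \<le> N (g v)"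
      "\<And>v. N (g v) \<le> u * norm v"
    by (rule euclidean_norm_equivalence[of "\<lambda>v. N (g v)"]) blast
  define h where "h X = (X $$ (0, 0), X $$ (0, Suc 0), X $$ (Suc 0, 0), X $$ (Suc 0, Suc 0))"
    for X :: "real mat"
  have gh: "g (h X) = X" if "X \<in> carrier_mat 2 2" for X
    using that by (auto simp: g_def h_def intro!: eq_mat2I)
  have entry: "\<bar>X $$ (i, j)\<bar> \<le> norm (h X)" if "i < 2" "j < 2" for X i j
  proof -
    have "\<bar>p\<bar> \<le> norm (p, q, s, t) \<and> \<bar>q\<bar> \<le> norm (p, q, s, t)
      \<and> \<bar>s\<bar> \<le> norm (p, q, s, t) \<and> \<bar>t\<bar> \<le> norm (p, q, s, t)" for p q s t :: real
      by (auto simp: norm_Pair intro!: real_le_rsqrt)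
    with that show ?thesis
      by (auto simp: h_def less_2_cases_iff)
  qed
  have entry': "norm (h X) \<le> 4 * B" if "\<And>i j. i < 2 \<Longrightarrow> j < 2 \<Longrightarrow> \<bar>X $$ (i, j)\<bar> \<le> B" for X B
  proof -
    have "norm (p, q, s, t) \<le> \<bar>p\<bar> + \<bar>q\<bar> + \<bar>s\<bar> + \<bar>t\<bar>" for p q s t :: real
      using norm_Pair_le[of p "(q, s, t)"] norm_Pair_le[of q "(s, t)"] norm_Pair_le[of s t]
      by simp
    from this[of "X $$ (0, 0)" "X $$ (0, Suc 0)" "X $$ (Suc 0, 0)" "X $$ (Suc 0, Suc 0)"]
      that[of 0 0] that[of 0 1] that[of 1 0] that[of 1 1]
    show ?thesis by (simp add: h_def)
  qed
  show ?thesis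
  proof (rule that[of l "u * 4"])
    fix X :: "real mat" and i j :: nat
    assume "X \<in> carrier_mat 2 2" "i < 2" "j < 2"
    then show "l * \<bar>X $$ (i, j)\<bar> \<le> N X"
      using order_trans[OF mult_left_mono[OF entry less_imp_le[OF lu(1)]] lu(3), of i j X] by (simp add: gh)
  next
    fix X :: "real mat" and B :: real
    assume "X \<in> carrier_mat 2 2" "\<And>i j. i < 2 \<Longrightarrow> j < 2 \<Longrightarrow> \<bar>X $$ (i, j)\<bar> \<le> B"
    then show "N X \<le> u * 4 * B"
      using order_trans[OF lu(4) mult_left_mono[OF entry' less_imp_le[OF lu(2)]], of X B] by (simp add: gh)
  qed (use lu in auto)
qed

section \<open>Eigenvalues and the spectral radius\<close>

text \<open>The right-hand side is the characteristic equation, kept in factored form: with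
  \<open>q * s = 0\<close> the diagonal entries are visibly the roots.\<close>

lemma eigenvalue_mat2:
  fixes p q s t z :: complex
  shows "eigenvalue (mat2 p q s t) z \<longleftrightarrow> (z - p) * (z - t) = q * s"
proof -
  have iff: "eigenvalue (mat2 p q s t) z \<longleftrightarrow>
    (\<exists>x y. (x \<noteq> 0 \<or> y \<noteq> 0) \<and> p * x + q * y = z * x \<and> s * x + t * y = z * y)"
  proof
    assume "eigenvalue (mat2 p q s t) z"
    then obtain v where v: "v \<in> carrier_vec 2" "v \<noteq> 0\<^sub>v 2" "mat2 p q s t *\<^sub>v v = z \<cdot>\<^sub>v v"
      by (auto simp: eigenvalue_def eigenvector_def)
    have "(mat2 p q s t *\<^sub>v v) $ i = z * v $ i" if "i < 2" for i
      using that v by simp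
    from this[of 0] this[of 1]
    have "p * v $ 0 + q * v $ 1 = z * v $ 0" "s * v $ 0 + t * v $ 1 = z * v $ 1"
      by (simp_all add: mat2_mult_vec_index[OF _ v(1)] del: index_mult_mat_vec)
    moreover have "v $ 0 \<noteq> 0 \<or> v $ 1 \<noteq> 0"
      using v(1,2) by (auto simp: less_2_cases_iff intro!: eq_vecI)
    ultimately show "\<exists>x y. (x \<noteq> 0 \<or> y \<noteq> 0) \<and> p * x + q * y = z * x \<and> s * x + t * y = z * y"
      by blast
  next
    assume "\<exists>x y. (x \<noteq> 0 \<or> y \<noteq> 0) \<and> p * x + q * y = z * x \<and> s * x + t * y = z * y"
    then obtain x y where xy: "x \<noteq> 0 \<or> y \<noteq> 0" "p * x + q * y = z * x" "s * x + t * y = z * y"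
      by blast
    define v where "v = vec 2 (\<lambda>i. if i = 0 then x else y)"
    have v: "v \<in> carrier_vec 2" "v $ 0 = x" "v $ Suc 0 = y"
      by (simp_all add: v_def)
    have "v \<noteq> 0\<^sub>v 2"
    proof
      assume "v = 0\<^sub>v 2"
      then have "v $ 0 = 0" "v $ Suc 0 = 0"
        by simp_all
      with v xy(1) show False
        by simp
    qed
    moreover have "mat2 p q s t *\<^sub>v v = z \<cdot>\<^sub>v v"
      using v xy(2,3)
      by (intro eq_vecI) (auto simp: mat2_mult_vec_index less_2_cases_iff simp del: index_mult_mat_vec)
    ultimately show "eigenvalue (mat2 p q s t) z"
      using v(1) by (auto simp: eigenvalue_def eigenvector_def)
  qed
  show ?thesis
  proof
    assume "eigenvalue (mat2 p q s t) z"
    then obtain x y where xy: "x \<noteq> 0 \<or> y \<noteq> 0" "p * x + q * y = z * x" "s * x + t * y = z * y"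
      using iff by blast
    then have *: "(z - p) * x = q * y" "(z - t) * y = s * x"
      by (simp_all add: algebra_simps)
    \<comment> \<open>Eliminating either coordinate shows that \<open>(z - p) * (z - t)\<close> and
      \<open>q * s\<close> agree after multiplication by \<open>x\<close> and by \<open>y\<close>,
      one of which is nonzero.\<close>
    have "(z - p) * (z - t) * x = (z - t) * ((z - p) * x)"
      by simp
    also have "\<dots> = q * ((z - t) * y)"
      unfolding *(1) by simp
    also have "\<dots> = q * s * x"
      unfolding *(2) by simp
    finally have x: "(z - p) * (z - t) * x = q * s * x" .
    have "(z - p) * (z - t) * y = (z - p) * ((z - t) * y)"
      by simp
    also have "\<dots> = s * ((z - p) * x)"
      unfolding *(2) by simp
    also have "\<dots> = q * s * y"
      unfolding *(1) by simp
    finally show "(z - p) * (z - t) = q * s"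
      using x xy(1) by auto
  next
    assume *: "(z - p) * (z - t) = q * s"
    \<comment> \<open>A nonzero off-diagonal entry yields the eigenvector \<open>(q, z - p)\<close>
      or \<open>(z - t, s)\<close>; for a diagonal matrix a unit vector works.\<close>
    consider "q \<noteq> 0" | "s \<noteq> 0" | "q = 0" "s = 0" "z = p" | "q = 0" "s = 0" "z = t"
      using * by force
    then show "eigenvalue (mat2 p q s t) z"
    proof cases
      case 1
      with * show ?thesis
        unfolding iff by (intro exI[of _ q] exI[of _ "z - p"]) (simp add: algebra_simps)
    next
      case 2
      with * show ?thesis
        unfolding iff by (intro exI[of _ "z - t"] exI[of _ s]) (simp add: algebra_simps)
    next
      case 3
      then show ?thesis
        unfolding iff by (intro exI[of _ 1] exI[of _ 0]) simp
    next
      case 4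
      then show ?thesis
        unfolding iff by (intro exI[of _ 0] exI[of _ 1]) simp
    qed
  qed
qed

text \<open>The spectrum is finite, and nonempty because \<open>n > 0\<close>, so its maximum is
  below \<open>x\<close> exactly when every member is.\<close>

lemma real_spectral_radius_less_iff:
  assumes "X \<in> carrier_mat n n" "n > 0"
  shows "real_spectral_radius X < x \<longleftrightarrow>
    (\<forall>z. eigenvalue (map_mat complex_of_real X) z \<longrightarrow> cmod z < x)"
proof -
  have "map_mat complex_of_real X \<in> carrier_mat n n"
    using assms(1) by simp
  then show ?thesis
    unfolding real_spectral_radius_def spectral_radius_def
    using assms(2) card_finite_spectrum(1)[of "map_mat complex_of_real X" n]
      spectrum_non_empty[of "map_mat complex_of_real X" n]
    by (subst Max_less_iff) (auto simp: spectrum_def)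
qed

lemma real_spectral_radius_mat2_less_iff:
  "real_spectral_radius (mat2 p q s t) < x \<longleftrightarrow>
    (\<forall>z. (z - of_real p) * (z - of_real t) = of_real (q * s) \<longrightarrow> cmod z < x)"
proof -
  have "map_mat complex_of_real (mat2 p q s t)
      = mat2 (of_real p) (of_real q) (of_real s) (of_real t)"
    by (rule eq_mat2I) simp_all
  then show ?thesis
    by (simp add: real_spectral_radius_less_iff[of _ 2] eigenvalue_mat2)
qed

text \<open>Real roots suffice for the sufficiency direction: the discriminant
  \<open>(p - t)\<^sup>2 + 4 * r\<^sup>2 * (b * c)\<close> is nonnegative there.\<close>

lemma real_spectral_radius_mat2_less_real:
  fixes z :: real
  assumes "real_spectral_radius (mat2 p q s t) < x" "(z - p) * (z - t) = q * s"
  shows "\<bar>z\<bar> < x"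
proof -
  have "(complex_of_real z - of_real p) * (of_real z - of_real t) = of_real (q * s)"
    unfolding assms(2)[symmetric] by simp
  with assms(1) show ?thesis
    unfolding real_spectral_radius_mat2_less_iff by fastforce
qed

section \<open>Contractions and stability\<close>

lemma finite_mat_set_power: "finite S \<Longrightarrow> finite (mat_set_power n S k)"
proof -
  assume "finite S"
  then have "finite {Ms. set Ms \<subseteq> S \<and> length Ms = k}"
    by (rule finite_lists_length_eq)
  moreover have "mat_set_power n S k
      = (\<lambda>Ms. foldr (*) Ms (1\<^sub>m n)) ` {Ms. set Ms \<subseteq> S \<and> length Ms = k}"
    by (auto simp: mat_set_power_def)
  ultimately show ?thesis by simp
qed

lemma mat_set_power_carrier:
  assumes "S \<subseteq> carrier_mat n n" "X \<in> mat_set_power n S k"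
  shows "X \<in> carrier_mat n n"
proof -
  have "foldr (*) Ms (1\<^sub>m n) \<in> carrier_mat n n" if "set Ms \<subseteq> S" for Ms
    using that assms(1) by (induction Ms) auto
  with assms(2) show ?thesis by (auto simp: mat_set_power_def)
qed

lemma pow_mat_in_mat_set_power:
  assumes "X \<in> S" "X \<in> carrier_mat n n"
  shows "X ^\<^sub>m k \<in> mat_set_power n S k"
proof -
  have "foldr (*) (replicate k X) Y = X ^\<^sub>m k * Y" if "Y \<in> carrier_mat n n" for Y
    using that assms(2)
  proof (induction k arbitrary: Y)
    case (Suc k)
    \<comment> \<open>One factor is split off at the right end and absorbed into the seed
      \<open>Y\<close>, matching the recursion of \<open>^\<^sub>m\<close>, which multiplies on the
      right.\<close>
    have "foldr (*) (replicate (Suc k) X) Y = foldr (*) (replicate k X) (X * Y)"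
      by (simp add: replicate_append_same[symmetric] del: replicate_append_same)
    also have "\<dots> = X ^\<^sub>m Suc k * Y"
      using Suc by (simp add: assoc_mult_mat[of _ n n _ n _ n])
    finally show ?case .
  qed simp
  from this[of "1\<^sub>m n"] show ?thesis
    using assms by (auto simp: mat_set_power_def intro!: exI[of _ "replicate k X"])
qed

text \<open>A product of \<open>k\<close> members shrinks \<nu> by the \<open>k\<close>-th power of
  a common factor below 1. Since \<nu> controls the coordinates up to \<open>B\<close>, all entries
  of the product, and with them its norm, decay geometrically.\<close>

lemma absolutely_stable_if_contraction:
  fixes \<nu> :: "real \<Rightarrow> real \<Rightarrow> real"
  assumes N: "matrix_norm 2 N" and S: "finite S" "S \<noteq> {}" "S \<subseteq> carrier_mat 2 2"
    and B: "0 < B"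
    and bound: "\<And>x y. \<bar>x\<bar> \<le> B * \<nu> x y" "\<And>x y. \<bar>y\<bar> \<le> B * \<nu> x y"
    and contrs: "\<And>X. X \<in> S \<Longrightarrow> \<exists>q\<ge>0. q < 1 \<and> (\<forall>x y.
      \<nu> (X $$ (0, 0) * x + X $$ (0, 1) * y) (X $$ (1, 0) * x + X $$ (1, 1) * y) \<le> q * \<nu> x y)"
  shows "absolutely_stable N 2 S"
proof -
  have \<nu>: "0 \<le> \<nu> x y" for x y
    using order_trans[OF abs_ge_zero bound(1)] B by (simp add: zero_le_mult_iff)
  obtain f where f: "\<And>X. X \<in> S \<Longrightarrow> 0 \<le> f X \<and> f X < 1 \<and> (\<forall>x y.
      \<nu> (X $$ (0, 0) * x + X $$ (0, 1) * y) (X $$ (1, 0) * x + X $$ (1, 1) * y) \<le> f X * \<nu> x y)"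
    using contrs by metis
  \<comment> \<open>Finiteness of \<open>S\<close> turns the individual contraction factors into one
    that is still below 1.\<close>
  define q where "q = Max (f ` S)"
  have f_le: "f X \<le> q" if "X \<in> S" for X
    using S(1) that by (simp add: q_def)
  have "q \<in> f ` S"
    unfolding q_def using S by (intro Max_in) auto
  then have q: "0 \<le> q" "q < 1"
    using f by auto
  have contr: "\<nu> (X $$ (0, 0) * x + X $$ (0, 1) * y) (X $$ (1, 0) * x + X $$ (1, 1) * y)
      \<le> q * \<nu> x y" if "X \<in> S" for X x y
    using order_trans[OF _ mult_right_mono[OF f_le[OF that] \<nu>]] f[OF that] by blast
  obtain l u where lu: "l > 0" "u > 0"
    "\<And>X i j. X \<in> carrier_mat 2 2 \<Longrightarrow> i < 2 \<Longrightarrow> j < 2 \<Longrightarrow> l * \<bar>X $$ (i, j)\<bar> \<le> N X"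
    "\<And>X B. X \<in> carrier_mat 2 2 \<Longrightarrow> (\<And>i j. i < 2 \<Longrightarrow> j < 2 \<Longrightarrow> \<bar>X $$ (i, j)\<bar> \<le> B) \<Longrightarrow> N X \<le> u * B"
    using matrix_norm_2_entries[OF N] by blast
  have iter: "\<nu> (X $$ (0, 0) * x + X $$ (0, 1) * y) (X $$ (1, 0) * x + X $$ (1, 1) * y)
      \<le> q ^ k * \<nu> x y"
    if X: "X \<in> mat_set_power 2 S k" for X k x y
  proof -
    obtain Ms where Ms: "X = foldr (*) Ms (1\<^sub>m 2)" "length Ms = k" "set Ms \<subseteq> S"
      using X by (auto simp: mat_set_power_def)
    have "\<nu> (P $$ (0, 0) * x + P $$ (0, 1) * y) (P $$ (1, 0) * x + P $$ (1, 1) * y)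
        \<le> q ^ length Ms * \<nu> x y"
      if "P = foldr (*) Ms (1\<^sub>m 2)" for P
      using that Ms(3)
    proof (induction Ms arbitrary: P)
      case (Cons M Ms)
      let ?P = "foldr (*) Ms (1\<^sub>m 2)"
      let ?x = "?P $$ (0, 0) * x + ?P $$ (0, 1) * y" and ?y = "?P $$ (1, 0) * x + ?P $$ (1, 1) * y"
      have car: "M \<in> carrier_mat 2 2" "?P \<in> carrier_mat 2 2"
        using Cons.prems S(3) mat_set_power_carrier[OF S(3), of ?P "length Ms"]
        by (auto simp: mat_set_power_def)
      have "\<nu> (P $$ (0, 0) * x + P $$ (0, 1) * y) (P $$ (1, 0) * x + P $$ (1, 1) * y)
        = \<nu> (M $$ (0, 0) * ?x + M $$ (0, 1) * ?y) (M $$ (1, 0) * ?x + M $$ (1, 1) * ?y)"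
        by (simp add: Cons.prems(1) mat2_mult_index[OF car] algebra_simps del: index_mult_mat)
      also have "\<dots> \<le> q * \<nu> ?x ?y"
        using Cons.prems by (intro contr) auto
      also have "\<dots> \<le> q * (q ^ length Ms * \<nu> x y)"
        using Cons q by (intro mult_left_mono) auto
      finally show ?case by simp
    qed simp
    with Ms show ?thesis by blast
  qed
  define C where "C = u * (B * (max 0 (max (\<nu> 1 0) (\<nu> 0 1))))"
  have le: "N X \<le> C * q ^ k" if X: "X \<in> mat_set_power 2 S k" for X k
  proof -
    have car: "X \<in> carrier_mat 2 2"
      using mat_set_power_carrier[OF S(3) X] .
    \<comment> \<open>The columns of \<open>X\<close> are the images of \<open>(1, 0)\<close> and
      \<open>(0, 1)\<close>, so \<open>iter\<close> at these two vectors bounds every entry.\<close>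
    have "\<bar>X $$ (i, j)\<bar> \<le> B * (q ^ k * (max 0 (max (\<nu> 1 0) (\<nu> 0 1))))" if "i < 2" "j < 2" for i j
    proof -
      let ?m = "max 0 (max (\<nu> 1 0) (\<nu> 0 1))"
      have "B * (q ^ k * \<nu> 1 0) \<le> B * (q ^ k * ?m)" "B * (q ^ k * \<nu> 0 1) \<le> B * (q ^ k * ?m)"
        using B q by (auto intro!: mult_left_mono)
      moreover have "B * \<nu> (X $$ (0, 0)) (X $$ (1, 0)) \<le> B * (q ^ k * \<nu> 1 0)"
        "B * \<nu> (X $$ (0, 1)) (X $$ (1, 1)) \<le> B * (q ^ k * \<nu> 0 1)"
        using iter[OF X, of 1 0] iter[OF X, of 0 1] B by (auto intro!: mult_left_mono)
      ultimately show ?thesis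
        using bound[where x = "X $$ (0, 0)" and y = "X $$ (1, 0)"]
          bound[where x = "X $$ (0, 1)" and y = "X $$ (1, 1)"] that
        by (auto simp: less_2_cases_iff)
    qed
    from lu(4)[OF car this] show ?thesis
      by (simp add: C_def algebra_simps)
  qed
  \<comment> \<open>Powers of any one member show that the set of products is nonempty, so that
    \<open>Max\<close> is meaningful.\<close>
  obtain M where M: "M \<in> S" using S(2) by blast
  have ne: "mat_set_power 2 S k \<noteq> {}" for k
    using pow_mat_in_mat_set_power[OF M, of 2 k] M S(3) by auto
  have nonneg: "0 \<le> N X" if "X \<in> carrier_mat 2 2" for X
    using lu(3)[OF that, of 0 0] lu(1) by (smt (verit) abs_ge_zero mult_nonneg_nonneg zero_less_numeral)
  have "0 \<le> Max (N ` mat_set_power 2 S k)" for k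
    using ne[of k] nonneg mat_set_power_carrier[OF S(3), of _ k] finite_mat_set_power[OF S(1), of 2 k]
    by (subst Max_ge_iff) auto
  moreover have "Max (N ` mat_set_power 2 S k) \<le> C * q ^ k" for k
    using ne[of k] le finite_mat_set_power[OF S(1), of 2 k] by (subst Max_le_iff) auto
  moreover have "(\<lambda>k. C * q ^ k) \<longlonglongrightarrow> 0"
    using q by (auto intro!: tendsto_mult_right_zero LIMSEQ_realpow_zero)
  ultimately show ?thesis
    unfolding absolutely_stable_def
    using tendsto_sandwich[OF always_eventually always_eventually tendsto_const,
        of 0 "\<lambda>k. Max (N ` mat_set_power 2 S k)" "\<lambda>k. C * q ^ k"] by blast
qed

section \<open>Necessity of the spectral condition\<close>

text \<open>The powers of \<open>X\<close> are among the products, so their entries tend to 0. For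
  an eigenvector \<open>v\<close> with eigenvalue of modulus at least 1, each \<open>v $ i\<close>
  is bounded by the corresponding coordinate of the \<open>k\<close>-th power applied to
  \<open>v\<close>; letting \<open>k\<close> grow forces \<open>v = 0\<close>.\<close>

lemma real_spectral_radius_less_1_if_absolutely_stable:
  assumes N: "matrix_norm 2 N" and S: "finite S" "S \<subseteq> carrier_mat 2 2"
    and stable: "absolutely_stable N 2 S" and X: "X \<in> S"
  shows "real_spectral_radius X < 1"
proof (rule ccontr)
  assume "\<not> real_spectral_radius X < 1"
  have car: "X \<in> carrier_mat 2 2"
    using X S by blast
  define Z where "Z = map_mat complex_of_real X"
  have Z: "Z \<in> carrier_mat 2 2"
    using car by (simp add: Z_def)
  obtain z v where z: "cmod z \<ge> 1" and ev: "eigenvector Z v z"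
    using \<open>\<not> _\<close> real_spectral_radius_less_iff[OF car, of 1]
    by (auto simp: Z_def eigenvalue_def not_less)
  from ev Z have v: "v \<in> carrier_vec 2" "v \<noteq> 0\<^sub>v 2"
    by (auto simp: eigenvector_def)
  obtain l u where lu: "l > 0"
    "\<And>X i j. X \<in> carrier_mat 2 2 \<Longrightarrow> i < 2 \<Longrightarrow> j < 2 \<Longrightarrow> l * \<bar>X $$ (i, j)\<bar> \<le> N X"
    using matrix_norm_2_entries[OF N] by metis
  define m where "m k = Max (N ` mat_set_power 2 S k)" for k
  have m: "m \<longlonglongrightarrow> 0"
    using stable by (simp add: absolutely_stable_def m_def[abs_def])
  have entry: "\<bar>(X ^\<^sub>m k) $$ (i, j)\<bar> \<le> m k / l" if "i < 2" "j < 2" for i j k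
  proof -
    have "l * \<bar>(X ^\<^sub>m k) $$ (i, j)\<bar> \<le> N (X ^\<^sub>m k)"
      using that car by (intro lu(2)) auto
    also have "\<dots> \<le> m k"
      unfolding m_def
      using pow_mat_in_mat_set_power[OF X car] finite_mat_set_power[OF S(1)] by (intro Max_ge) auto
    finally show ?thesis
      using lu(1) by (simp add: field_simps)
  qed
  have "v $ i = 0" if i: "i < 2" for i
  proof -
    have "cmod (v $ i) \<le> m k / l * (cmod (v $ 0) + cmod (v $ 1))" for k
    proof -
      let ?e = "\<lambda>j. complex_of_real ((X ^\<^sub>m k) $$ (i, j))"
      have "Z ^\<^sub>m k = map_mat complex_of_real (X ^\<^sub>m k)"
        unfolding Z_def by (rule of_real_hom.mat_hom_pow[OF car, symmetric])
      moreover have "(Z ^\<^sub>m k *\<^sub>v v) $ i = z ^ k * v $ i"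
        using eigenvector_pow[OF Z ev] v i by simp
      ultimately have eq: "z ^ k * v $ i = ?e 0 * v $ 0 + ?e 1 * v $ 1"
        using i v(1) car pow_carrier_mat[OF car, of k]
        by (simp add: mat2_mult_vec_index del: index_mult_mat_vec)
      have "cmod (v $ i) \<le> cmod (z ^ k * v $ i)"
        using z by (simp add: norm_mult norm_power one_le_power mult_le_cancel_right1)
      also have "\<dots> \<le> cmod (?e 0) * cmod (v $ 0) + cmod (?e 1) * cmod (v $ 1)"
        unfolding eq by (rule order_trans[OF norm_triangle_ineq]) (simp add: norm_mult)
      also have "\<dots> \<le> m k / l * cmod (v $ 0) + m k / l * cmod (v $ 1)"
        using entry[OF i, of _ k] by (intro add_mono mult_right_mono) auto
      finally show ?thesis
        by (simp add: algebra_simps)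
    qed
    moreover have "(\<lambda>k. m k / l * (cmod (v $ 0) + cmod (v $ 1))) \<longlonglongrightarrow> 0"
      using m by (auto intro!: tendsto_mult_left_zero tendsto_divide_zero)
    ultimately have "cmod (v $ i) \<le> 0"
      by (intro LIMSEQ_le_const) auto
    then show ?thesis by simp
  qed
  with v show False
    by (auto intro!: eq_vecI)
qed

section \<open>The symmetrizable case \<open>b * c > 0\<close>\<close>

text \<open>Complete the square after multiplying by \<alpha>; if \<alpha> vanishes, so does
  \<beta>.\<close>

lemma quadratic_form_nonneg:
  fixes \<alpha> \<beta> \<gamma> x y :: real
  assumes "0 \<le> \<alpha>" "0 \<le> \<gamma>" "\<beta>\<^sup>2 \<le> \<alpha> * \<gamma>"
  shows "0 \<le> \<alpha> * x\<^sup>2 + 2 * \<beta> * x * y + \<gamma> * y\<^sup>2"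
proof (cases "\<alpha> = 0")
  case True
  with assms show ?thesis by simp
next
  case False
  have "\<alpha> * (\<alpha> * x\<^sup>2 + 2 * \<beta> * x * y + \<gamma> * y\<^sup>2) = (\<alpha> * x + \<beta> * y)\<^sup>2 + (\<alpha> * \<gamma> - \<beta>\<^sup>2) * y\<^sup>2"
    by (simp add: power2_eq_square algebra_simps)
  also have "\<dots> \<ge> 0"
    using assms(3) by (intro add_nonneg_nonneg mult_nonneg_nonneg) auto
  finally show ?thesis
    using False assms(1) by (simp add: zero_le_mult_iff)
qed

text \<open>Since \<open>b\<close> and \<open>c\<close> have the same sign, the matrix is
  self-adjoint for the weights \<open>\<bar>c\<bar>\<close>, \<open>\<bar>b\<bar>\<close>. The claim
  then says that \<open>q\<^sup>2 I - M\<^sup>2\<close> is positive semidefinite for this inner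
  product, where \<open>q\<close> is the larger modulus of the two eigenvalues.\<close>

lemma symmetrizable_mat2_contraction:
  assumes bc: "b * c > 0" and \<rho>: "real_spectral_radius (mat2 p (r * b) (r * c) t) < 1"
  obtains q where "0 \<le> q" "q < 1"
    "\<And>x y. sqrt (\<bar>c\<bar> * (p * x + r * b * y)\<^sup>2 + \<bar>b\<bar> * (r * c * x + t * y)\<^sup>2)
       \<le> q * sqrt (\<bar>c\<bar> * x\<^sup>2 + \<bar>b\<bar> * y\<^sup>2)"
proof -
  \<comment> \<open>The product of the off-diagonal entries; its nonnegativity makes the eigenvalues
    \<open>z1\<close> and \<open>z2\<close> below real.\<close>
  define e where "e = r\<^sup>2 * (b * c)"
  define \<Delta> where "\<Delta> = sqrt ((p - t)\<^sup>2 + 4 * e)"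
  have \<Delta>2: "\<Delta>\<^sup>2 = (p - t)\<^sup>2 + 4 * e"
    unfolding \<Delta>_def using bc by (intro real_sqrt_pow2) (auto simp: e_def)
  define z1 z2 where "z1 = (p + t + \<Delta>) / 2" and "z2 = (p + t - \<Delta>) / 2"
  have sum: "z1 + z2 = p + t" and prod: "z1 * z2 = p * t - e"
    using \<Delta>2 by (auto simp: z1_def z2_def field_simps power2_eq_square)
  have "z1 * z1 - z1 * (p + t) + p * t = (r * b) * (r * c)"
    "z2 * z2 - z2 * (p + t) + p * t = (r * b) * (r * c)"
    using prod unfolding sum[symmetric] e_def by (simp_all add: algebra_simps power2_eq_square)
  then have "(z1 - p) * (z1 - t) = (r * b) * (r * c)" "(z2 - p) * (z2 - t) = (r * b) * (r * c)"
    by (simp_all add: algebra_simps)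
  then have z: "\<bar>z1\<bar> < 1" "\<bar>z2\<bar> < 1"
    using real_spectral_radius_mat2_less_real[OF \<rho>] by auto
  define q where "q = max \<bar>z1\<bar> \<bar>z2\<bar>"
  have q: "0 \<le> q" "q < 1"
    using z by (auto simp: q_def)
  have le: "z1\<^sup>2 \<le> q\<^sup>2" "z2\<^sup>2 \<le> q\<^sup>2"
    by (auto simp: q_def abs_le_square_iff[symmetric])
  \<comment> \<open>The diagonal entries of \<open>q\<^sup>2 I - M\<^sup>2\<close>; the product of
    its off-diagonal entries is \<open>e * (p + t)\<^sup>2\<close>.\<close>
  define \<alpha> \<delta> where "\<alpha> = q\<^sup>2 - p\<^sup>2 - e" and "\<delta> = q\<^sup>2 - t\<^sup>2 - e"
  \<comment> \<open>Below, \<open>tr\<close> and \<open>det\<close> are the trace and determinant of \<open>q\<^sup>2 I - M\<^sup>2\<close>, where \<open>M\<close> is the matrix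
    in question; being nonnegative, they make \<open>q\<^sup>2 I - M\<^sup>2\<close> positive semidefinite.\<close>
  have "z1\<^sup>2 + z2\<^sup>2 = (z1 + z2)\<^sup>2 - 2 * (z1 * z2)"
    by (simp add: power2_eq_square algebra_simps)
  then have squares: "z1\<^sup>2 + z2\<^sup>2 = p\<^sup>2 + t\<^sup>2 + 2 * e"
    unfolding sum prod by (simp add: power2_eq_square algebra_simps)
  then have tr: "\<alpha> + \<delta> = (q\<^sup>2 - z1\<^sup>2) + (q\<^sup>2 - z2\<^sup>2)"
    unfolding \<alpha>_def \<delta>_def by simp
  have "(q\<^sup>2 - z1\<^sup>2) * (q\<^sup>2 - z2\<^sup>2) = q\<^sup>2 * q\<^sup>2 - q\<^sup>2 * (z1\<^sup>2 + z2\<^sup>2) + (z1 * z2)\<^sup>2"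
    by (simp add: power2_eq_square algebra_simps)
  then have det: "\<alpha> * \<delta> - e * (p + t)\<^sup>2 = (q\<^sup>2 - z1\<^sup>2) * (q\<^sup>2 - z2\<^sup>2)"
    unfolding squares prod \<alpha>_def \<delta>_def by (simp add: power2_eq_square algebra_simps)
  have det_nonneg: "e * (p + t)\<^sup>2 \<le> \<alpha> * \<delta>"
    using mult_nonneg_nonneg[of "q\<^sup>2 - z1\<^sup>2" "q\<^sup>2 - z2\<^sup>2"] le unfolding det[symmetric] by simp
  moreover have "0 \<le> e * (p + t)\<^sup>2"
    using bc by (auto simp: e_def)
  ultimately have "0 \<le> \<alpha> * \<delta>" by simp
  \<comment> \<open>Two reals with nonnegative sum and nonnegative product are both
    nonnegative.\<close>
  with tr le have \<alpha>\<delta>: "0 \<le> \<alpha>" "0 \<le> \<delta>"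
    by (auto simp: zero_le_mult_iff)
  show ?thesis
  proof (rule that[OF q])
    fix x y
    \<comment> \<open>The mixed coefficient of the quadratic form of
      \<open>q\<^sup>2 I - M\<^sup>2\<close> in the weighted inner product: the weight
      \<open>\<bar>c\<bar>\<close> times the upper off-diagonal entry.\<close>
    define \<beta> where "\<beta> = - (r * (\<bar>c\<bar> * b) * (p + t))"
    have sgn: "\<bar>b\<bar> * c = \<bar>c\<bar> * b" "\<bar>c\<bar> * \<bar>b\<bar> = b * c"
      using bc by (auto simp: abs_if zero_less_mult_iff)
    have "\<beta>\<^sup>2 = (b * c) * (e * (p + t)\<^sup>2)"
      by (simp add: \<beta>_def e_def power2_eq_square algebra_simps)
    also have "\<dots> \<le> (b * c) * (\<alpha> * \<delta>)"
      using bc det_nonneg by (intro mult_left_mono) auto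
    also have "\<dots> = (\<bar>c\<bar> * \<alpha>) * (\<bar>b\<bar> * \<delta>)"
      using sgn(2) by (simp add: algebra_simps)
    finally have "0 \<le> (\<bar>c\<bar> * \<alpha>) * x\<^sup>2 + 2 * \<beta> * x * y + (\<bar>b\<bar> * \<delta>) * y\<^sup>2"
      using \<alpha>\<delta> by (intro quadratic_form_nonneg) auto
    also have "\<dots> = q\<^sup>2 * (\<bar>c\<bar> * x\<^sup>2 + \<bar>b\<bar> * y\<^sup>2)
        - (\<bar>c\<bar> * (p * x + r * b * y)\<^sup>2 + \<bar>b\<bar> * (r * c * x + t * y)\<^sup>2)"
    proof -
      \<comment> \<open>Self-adjointness, in the form
        \<open>\<bar>b\<bar> * c = \<bar>c\<bar> * b\<close>, converts the terms with
        \<open>e\<close> into the squares that arise from expanding the right-hand side.\<close>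
      have "\<bar>c\<bar> * e = r\<^sup>2 * c * (\<bar>c\<bar> * b)"
        by (simp add: e_def algebra_simps)
      also have "\<dots> = \<bar>b\<bar> * (r * c)\<^sup>2"
        unfolding sgn(1)[symmetric] by (simp add: power2_eq_square algebra_simps)
      finally have ce: "\<bar>c\<bar> * e = \<bar>b\<bar> * (r * c)\<^sup>2" .
      have "\<bar>b\<bar> * e = r\<^sup>2 * b * (\<bar>b\<bar> * c)"
        by (simp add: e_def algebra_simps)
      also have "\<dots> = \<bar>c\<bar> * (r * b)\<^sup>2"
        unfolding sgn(1) by (simp add: power2_eq_square algebra_simps)
      finally have be: "\<bar>b\<bar> * e = \<bar>c\<bar> * (r * b)\<^sup>2" .
      have "\<bar>c\<bar> * \<alpha> = \<bar>c\<bar> * (q\<^sup>2 - p\<^sup>2) - \<bar>b\<bar> * (r * c)\<^sup>2"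
        "\<bar>b\<bar> * \<delta> = \<bar>b\<bar> * (q\<^sup>2 - t\<^sup>2) - \<bar>c\<bar> * (r * b)\<^sup>2"
        by (simp_all add: \<alpha>_def \<delta>_def right_diff_distrib ce be)
      moreover have "\<beta> = - (r * (\<bar>c\<bar> * b) * p + r * (\<bar>b\<bar> * c) * t)"
        unfolding sgn(1) by (simp add: \<beta>_def algebra_simps)
      ultimately show ?thesis
        by (simp only:) (simp add: power2_eq_square algebra_simps)
    qed
    finally have "sqrt (\<bar>c\<bar> * (p * x + r * b * y)\<^sup>2 + \<bar>b\<bar> * (r * c * x + t * y)\<^sup>2)
        \<le> sqrt (q\<^sup>2 * (\<bar>c\<bar> * x\<^sup>2 + \<bar>b\<bar> * y\<^sup>2))"
      by simp
    also have "\<dots> = q * sqrt (\<bar>c\<bar> * x\<^sup>2 + \<bar>b\<bar> * y\<^sup>2)"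
      using q by (simp add: real_sqrt_mult)
    finally show "sqrt (\<bar>c\<bar> * (p * x + r * b * y)\<^sup>2 + \<bar>b\<bar> * (r * c * x + t * y)\<^sup>2)
        \<le> q * sqrt (\<bar>c\<bar> * x\<^sup>2 + \<bar>b\<bar> * y\<^sup>2)" .
  qed
qed

section \<open>The triangular case \<open>b * c = 0\<close>\<close>

text \<open>Rescaling the second coordinate by \<open>w\<close> divides the off-diagonal entry by
  \<open>w\<close>; the two bounds on \<open>q\<close> then bound the absolute row sums of the
  rescaled matrix.\<close>

lemma weighted_max_contraction:
  fixes w q :: real
  assumes "0 < w" "\<bar>p\<bar> + \<bar>\<beta>\<bar> / w \<le> q" "\<bar>t\<bar> \<le> q"
  shows "max \<bar>p * x + \<beta> * y\<bar> (w * \<bar>t * y\<bar>) \<le> q * max \<bar>x\<bar> (w * \<bar>y\<bar>)"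
proof -
  define m where "m = max \<bar>x\<bar> (w * \<bar>y\<bar>)"
  have "\<bar>p * x + \<beta> * y\<bar> \<le> \<bar>p\<bar> * \<bar>x\<bar> + \<bar>\<beta>\<bar> / w * (w * \<bar>y\<bar>)"
    using assms(1) abs_triangle_ineq[of "p * x" "\<beta> * y"] by (simp add: abs_mult)
  also have "\<dots> \<le> \<bar>p\<bar> * m + \<bar>\<beta>\<bar> / w * m"
    using assms(1) by (intro add_mono mult_left_mono) (auto simp: m_def)
  also have "\<dots> = (\<bar>p\<bar> + \<bar>\<beta>\<bar> / w) * m"
    by (simp add: algebra_simps)
  also have "\<dots> \<le> q * m"
    using assms(2) by (intro mult_right_mono) (auto simp: m_def)
  finally have "\<bar>p * x + \<beta> * y\<bar> \<le> q * m" .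
  moreover have "\<bar>t\<bar> * (w * \<bar>y\<bar>) \<le> q * m"
    using assms by (intro mult_mono) (auto simp: m_def)
  then have "w * \<bar>t * y\<bar> \<le> q * m"
    by (simp add: abs_mult ac_simps)
  ultimately show ?thesis
    unfolding m_def by (rule max.boundedI)
qed

lemma exists_weight:
  fixes p \<beta> t :: "'a \<Rightarrow> real"
  assumes "finite S" and lt: "\<And>X. X \<in> S \<Longrightarrow> \<bar>p X\<bar> < 1 \<and> \<bar>t X\<bar> < 1"
  obtains w where "w \<ge> 1"
    "\<And>X. X \<in> S \<Longrightarrow> \<exists>q\<ge>0. q < 1 \<and>
      (\<forall>x y. max \<bar>p X * x + \<beta> X * y\<bar> (w * \<bar>t X * y\<bar>) \<le> q * max \<bar>x\<bar> (w * \<bar>y\<bar>))"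
proof -
  \<comment> \<open>One weight must serve all of \<open>S\<close>. The sum dominates each of its
    terms and the 1 makes this strict, which rearranges to \<open>lt1\<close>; it also gives
    \<open>w \<ge> 1\<close>, by which the weighted maximum dominates both coordinates.\<close>
  define w where "w = 1 + (\<Sum>X\<in>S. \<bar>\<beta> X\<bar> / (1 - \<bar>p X\<bar>))"
  have pos: "0 \<le> \<bar>\<beta> X\<bar> / (1 - \<bar>p X\<bar>)" if "X \<in> S" for X
    using lt[OF that] by simp
  have w: "w \<ge> 1"
    unfolding w_def using pos by (simp add: sum_nonneg)
  have lt1: "\<bar>p X\<bar> + \<bar>\<beta> X\<bar> / w < 1" if "X \<in> S" for X
  proof -
    have "\<bar>\<beta> X\<bar> / (1 - \<bar>p X\<bar>) < w"
      unfolding w_def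
      using member_le_sum[of X S "\<lambda>X. \<bar>\<beta> X\<bar> / (1 - \<bar>p X\<bar>)"] that pos \<open>finite S\<close> by simp
    then show ?thesis
      using lt[OF that] w by (simp add: field_simps)
  qed
  show ?thesis
  proof (rule that[OF w])
    fix X assume X: "X \<in> S"
    define q where "q = max (\<bar>p X\<bar> + \<bar>\<beta> X\<bar> / w) \<bar>t X\<bar>"
    have "0 \<le> q" "q < 1"
      using lt[OF X] lt1[OF X] by (auto simp: q_def le_max_iff_disj)
    moreover have "max \<bar>p X * x + \<beta> X * y\<bar> (w * \<bar>t X * y\<bar>) \<le> q * max \<bar>x\<bar> (w * \<bar>y\<bar>)" for x y
      using w by (intro weighted_max_contraction) (auto simp: q_def)
    ultimately show "\<exists>q\<ge>0. q < 1 \<and>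
        (\<forall>x y. max \<bar>p X * x + \<beta> X * y\<bar> (w * \<bar>t X * y\<bar>) \<le> q * max \<bar>x\<bar> (w * \<bar>y\<bar>))"
      by blast
  qed
qed

lemma absolutely_stable_upper_triangular:
  assumes N: "matrix_norm 2 N" and S: "finite S" "S \<noteq> {}" "S \<subseteq> carrier_mat 2 2"
    and X: "\<And>X. X \<in> S \<Longrightarrow> X $$ (1, 0) = 0"
    and diag: "\<And>X. X \<in> S \<Longrightarrow> \<bar>X $$ (0, 0)\<bar> < 1 \<and> \<bar>X $$ (1, 1)\<bar> < 1"
  shows "absolutely_stable N 2 S"
proof -
  obtain w where w: "w \<ge> 1" "\<And>X. X \<in> S \<Longrightarrow> \<exists>q\<ge>0. q < 1 \<and> (\<forall>x y.
      max \<bar>X $$ (0, 0) * x + X $$ (0, 1) * y\<bar> (w * \<bar>X $$ (1, 1) * y\<bar>) \<le> q * max \<bar>x\<bar> (w * \<bar>y\<bar>))"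
    by (rule exists_weight[where p = "\<lambda>X. X $$ (0, 0)" and \<beta> = "\<lambda>X. X $$ (0, 1)"
      and t = "\<lambda>X. X $$ (1, 1)", OF S(1) diag]) (blast+)
  have weight: "\<bar>y\<bar> \<le> max \<bar>x\<bar> (w * \<bar>y\<bar>)" for x y
    using w(1) by (simp add: le_max_iff_disj mult_le_cancel_right1)
  have contr: "\<exists>q\<ge>0. q < 1 \<and> (\<forall>x y. max \<bar>X $$ (0, 0) * x + X $$ (0, 1) * y\<bar>
      (w * \<bar>X $$ (1, 0) * x + X $$ (1, 1) * y\<bar>) \<le> q * max \<bar>x\<bar> (w * \<bar>y\<bar>))" if "X \<in> S" for X
    using w(2)[OF that] by (simp only: X[OF that] mult_zero_left add_0_left)
  show ?thesis
  proof (rule absolutely_stable_if_contraction[OF N S, where B = 1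
        and \<nu> = "\<lambda>x y. max \<bar>x\<bar> (w * \<bar>y\<bar>)"])
    show "0 < (1::real)"
      by simp
    fix x y
    show "\<bar>x\<bar> \<le> 1 * max \<bar>x\<bar> (w * \<bar>y\<bar>)" "\<bar>y\<bar> \<le> 1 * max \<bar>x\<bar> (w * \<bar>y\<bar>)"
      using weight by (simp_all only: mult_1 max.cobounded1)
  qed (rule contr)
qed

text \<open>Exchanging the two coordinates makes the matrices upper triangular, so the same weight
  argument applies with the weight on the first coordinate.\<close>

lemma absolutely_stable_lower_triangular:
  assumes N: "matrix_norm 2 N" and S: "finite S" "S \<noteq> {}" "S \<subseteq> carrier_mat 2 2"
    and X: "\<And>X. X \<in> S \<Longrightarrow> X $$ (0, 1) = 0"
    and diag: "\<And>X. X \<in> S \<Longrightarrow> \<bar>X $$ (0, 0)\<bar> < 1 \<and> \<bar>X $$ (1, 1)\<bar> < 1"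
  shows "absolutely_stable N 2 S"
proof -
  have diag': "\<bar>X $$ (1, 1)\<bar> < 1 \<and> \<bar>X $$ (0, 0)\<bar> < 1" if "X \<in> S" for X
    using diag[OF that] by simp
  obtain w where w: "w \<ge> 1" "\<And>X. X \<in> S \<Longrightarrow> \<exists>q\<ge>0. q < 1 \<and> (\<forall>y x.
      max \<bar>X $$ (1, 1) * y + X $$ (1, 0) * x\<bar> (w * \<bar>X $$ (0, 0) * x\<bar>) \<le> q * max \<bar>y\<bar> (w * \<bar>x\<bar>))"
    by (rule exists_weight[where p = "\<lambda>X. X $$ (1, 1)" and \<beta> = "\<lambda>X. X $$ (1, 0)"
      and t = "\<lambda>X. X $$ (0, 0)", OF S(1) diag']) (blast+)
  have weight: "\<bar>x\<bar> \<le> max \<bar>y\<bar> (w * \<bar>x\<bar>)" for x y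
    using w(1) by (simp add: le_max_iff_disj mult_le_cancel_right1)
  have contr: "\<exists>q\<ge>0. q < 1 \<and> (\<forall>x y. max \<bar>X $$ (1, 0) * x + X $$ (1, 1) * y\<bar>
      (w * \<bar>X $$ (0, 0) * x + X $$ (0, 1) * y\<bar>) \<le> q * max \<bar>y\<bar> (w * \<bar>x\<bar>))" if X0: "X \<in> S" for X
  proof -
    obtain q where q: "0 \<le> q" "q < 1" "\<And>x y. max \<bar>X $$ (1, 1) * y + X $$ (1, 0) * x\<bar>
        (w * \<bar>X $$ (0, 0) * x\<bar>) \<le> q * max \<bar>y\<bar> (w * \<bar>x\<bar>)"
      using w(2)[OF X0] by blast
    show ?thesis
      using q(3) by (intro exI[of _ q] conjI q allI)
        (simp only: X[OF X0] mult_zero_left add_0_left add_0_right add.commute)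
  qed
  show ?thesis
  proof (rule absolutely_stable_if_contraction[OF N S, where B = 1
        and \<nu> = "\<lambda>x y. max \<bar>y\<bar> (w * \<bar>x\<bar>)"])
    show "0 < (1::real)"
      by simp
    fix x y
    show "\<bar>x\<bar> \<le> 1 * max \<bar>y\<bar> (w * \<bar>x\<bar>)" "\<bar>y\<bar> \<le> 1 * max \<bar>y\<bar> (w * \<bar>x\<bar>)"
      using weight by (simp_all only: mult_1 max.cobounded1)
  qed (rule contr)
qed

section \<open>Assembling the cases\<close>

text \<open>The weights depend only on the shared \<open>b\<close> and \<open>c\<close>, not on
  \<open>p\<close>, \<open>r\<close>, \<open>t\<close>, so all members contract the same
  norm.\<close>

lemma absolutely_stable_symmetrizable:
  assumes N: "matrix_norm 2 N" and S: "finite S" "S \<noteq> {}"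
    and bc: "b * c > 0"
    and form: "\<And>X. X \<in> S \<Longrightarrow> \<exists>p r t. X = mat2 p (r * b) (r * c) t"
    and \<rho>: "\<And>X. X \<in> S \<Longrightarrow> real_spectral_radius X < 1"
  shows "absolutely_stable N 2 S"
proof -
  \<comment> \<open>The square of \<open>m\<close> is the smaller weight, hence the weighted norm is
    at least \<open>m\<close> times either coordinate.\<close>
  define m where "m = sqrt (min \<bar>c\<bar> \<bar>b\<bar>)"
  have m: "m > 0"
    using bc by (auto simp: m_def)
  let ?\<nu> = "\<lambda>x y. sqrt (\<bar>c\<bar> * x\<^sup>2 + \<bar>b\<bar> * y\<^sup>2)"
  have "m * \<bar>x\<bar> \<le> ?\<nu> x y \<and> m * \<bar>y\<bar> \<le> ?\<nu> x y" for x y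
  proof -
    have "min \<bar>c\<bar> \<bar>b\<bar> * x\<^sup>2 \<le> \<bar>c\<bar> * x\<^sup>2" "min \<bar>c\<bar> \<bar>b\<bar> * y\<^sup>2 \<le> \<bar>b\<bar> * y\<^sup>2"
      by (auto intro!: mult_right_mono)
    then have "min \<bar>c\<bar> \<bar>b\<bar> * x\<^sup>2 \<le> \<bar>c\<bar> * x\<^sup>2 + \<bar>b\<bar> * y\<^sup>2" "min \<bar>c\<bar> \<bar>b\<bar> * y\<^sup>2 \<le> \<bar>c\<bar> * x\<^sup>2 + \<bar>b\<bar> * y\<^sup>2"
      by (auto intro: add_increasing add_increasing2)
    then show ?thesis
      unfolding m_def by (metis real_sqrt_abs real_sqrt_le_mono real_sqrt_mult)
  qed
  then have bound: "\<bar>x\<bar> \<le> 1 / m * ?\<nu> x y" "\<bar>y\<bar> \<le> 1 / m * ?\<nu> x y" for x y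
    using m by (auto simp: field_simps)
  have contr: "\<exists>q\<ge>0. q < 1 \<and> (\<forall>x y.
      ?\<nu> (X $$ (0, 0) * x + X $$ (0, 1) * y) (X $$ (1, 0) * x + X $$ (1, 1) * y) \<le> q * ?\<nu> x y)"
    if X: "X \<in> S" for X
  proof -
    obtain p r t where prt: "X = mat2 p (r * b) (r * c) t"
      using form[OF X] by blast
    obtain q where "0 \<le> q" "q < 1"
      "\<And>x y. ?\<nu> (p * x + r * b * y) (r * c * x + t * y) \<le> q * ?\<nu> x y"
      using symmetrizable_mat2_contraction[OF bc \<rho>[OF X, unfolded prt]] by metis
    then show ?thesis
      by (intro exI[of _ q]) (simp add: prt)
  qed
  have "S \<subseteq> carrier_mat 2 2"
    using form by force
  from absolutely_stable_if_contraction[OF N S this _ bound contr] m show ?thesis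
    by simp
qed

theorem theorem6:
  fixes K :: nat
    and a b c d :: real
    and a' d' r :: "nat \<Rightarrow> real"
    and A :: "nat \<Rightarrow> real mat"
    and N :: "real mat \<Rightarrow> real"
  assumes "K \<ge> 1"
    and "b * c \<ge> 0"
    and "A 0 = mat_of_rows_list 2 [[a, b], [c, d]]"
    and "\<And>k. k \<in> {1..K} \<Longrightarrow>
           A k = mat_of_rows_list 2 [[a' k, r k * b], [r k * c, d' k]]"
    and "matrix_norm 2 N"
  shows "absolutely_stable N 2 (A ` {0..K}) \<longleftrightarrow>
           (\<forall>k \<in> {0..K}. real_spectral_radius (A k) < 1)"
proof -
  let ?S = "A ` {0..K}"
  \<comment> \<open>\<open>A 0\<close> joins the family with factor \<open>r = 1\<close>.\<close>
  have form: "\<exists>p r t. X = mat2 p (r * b) (r * c) t" if X: "X \<in> ?S" for X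
  proof -
    obtain k where k: "k \<in> {0..K}" "X = A k"
      using X by blast
    show ?thesis
    proof (cases "k = 0")
      case True
      then show ?thesis
        using assms(3) k by (intro exI[of _ a] exI[of _ 1] exI[of _ d]) simp
    next
      case False
      then show ?thesis
        using assms(4)[of k] k by auto
    qed
  qed
  have S: "finite ?S" "?S \<noteq> {}"
    by auto
  have car: "?S \<subseteq> carrier_mat 2 2"
    using form by force
  show ?thesis
  proof
    assume "absolutely_stable N 2 ?S"
    then show "\<forall>k \<in> {0..K}. real_spectral_radius (A k) < 1"
      using real_spectral_radius_less_1_if_absolutely_stable[OF assms(5) S(1) car] by blast
  next
    assume "\<forall>k \<in> {0..K}. real_spectral_radius (A k) < 1"
    then have \<rho>: "real_spectral_radius X < 1" if "X \<in> ?S" for X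
      using that by blast
    \<comment> \<open>With \<open>b * c = 0\<close> the characteristic equation becomes
      \<open>(z - p) * (z - t) = 0\<close>, so both diagonal entries are eigenvalues.\<close>
    have diag: "\<bar>X $$ (0, 0)\<bar> < 1 \<and> \<bar>X $$ (1, 1)\<bar> < 1" if X: "X \<in> ?S" and "b * c = 0" for X
    proof -
      obtain p r t where prt: "X = mat2 p (r * b) (r * c) t"
        using form[OF X] by blast
      have "r * b * (r * c) = 0"
        using \<open>b * c = 0\<close> by auto
      then show ?thesis
        using real_spectral_radius_mat2_less_real[OF \<rho>[OF X, unfolded prt], of p]
          real_spectral_radius_mat2_less_real[OF \<rho>[OF X, unfolded prt], of t]
        by (simp add: prt)
    qed
    consider "b * c > 0" | "b = 0" | "c = 0"
      using assms(2) by (force simp: less_le)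
    then show "absolutely_stable N 2 ?S"
    proof cases
      case 1
      from absolutely_stable_symmetrizable[OF assms(5) S 1 form \<rho>] show ?thesis .
    next
      case 2
      then show ?thesis
        using form by (intro absolutely_stable_lower_triangular[OF assms(5) S car] diag) force+
    next
      case 3
      then show ?thesis
        using form by (intro absolutely_stable_upper_triangular[OF assms(5) S car] diag) force+
    qed
  qed
qed

end
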